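(* Let $n\ge 2$ and $m\ge 1$ be integers, let $f:\mathbb{Z}_n^m\to\mathbb{Z}_n^m$ be a $\mathbb{Z}_n$-linear map, and let $s$ be the system height of the linear finite dynamical system $(\mathbb{Z}_n^m,f)$. If $n=p_1^{e_1}p_2^{e_2}\cdots p_\omega^{e_\omega}$ is the prime factorization of $n$ (with $p_1,\dots,p_\omega$ distinct primes and each $e_i\ge 1$), then $$s\le m\,e_{\max},$$ where $e_{\max}=\max\{e_1,\dots,e_\omega\}$ is the largest of the prime factor exponents.
   Context: $\mathbb{Z}_n$ denotes the ring of integers modulo $n$. A finite dynamical system is a pair $(X,f)$ with $X$ a finite set and $f:X\to X$ a function; it is linear when $X$ is a finite module over a finite commutative ring and $f$ is linear. An element $x_0\in X$ is a cycle vertex if $f^l(x_0)=x_0$ for some positive integer $l$. The height $h(x)$ of $x\in X$ is the number of iterations it takes for $x$ to reach a cycle vertex, i.e. the smallest integer $k\ge 0$ such that $f^k(x)$ is a cycle vertex. The system height (or height) of $(X,f)$ is $s=\max_{x\in X}h(x)$. *)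

theory Defs
  imports
    "HOL-Analysis.Cartesian_Space"
    "Berlekamp_Zassenhaus.Finite_Field"
begin

definition finite_dynamical_system :: "'a set \<Rightarrow> ('a \<Rightarrow> 'a) \<Rightarrow> bool" where
  "finite_dynamical_system X f \<longleftrightarrow> finite X \<and> f \<in> X \<rightarrow> X"

definition cycle_vertex :: "('a \<Rightarrow> 'a) \<Rightarrow> 'a \<Rightarrow> bool" where
  "cycle_vertex f x \<longleftrightarrow> (\<exists>l>0. (f ^^ l) x = x)"

definition height :: "('a \<Rightarrow> 'a) \<Rightarrow> 'a \<Rightarrow> nat" where
  "height f x = (LEAST k. cycle_vertex f ((f ^^ k) x))"

(* Max is only meaningful for a nonempty finite X. *)
definition system_height :: "'a set \<Rightarrow> ('a \<Rightarrow> 'a) \<Rightarrow> nat" where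
  "system_height X f = Max (height f ` X)"

(* In a finite dynamical system the LEAST in height is attained. *)
lemma cycle_vertex_height:
  assumes "finite_dynamical_system X f" and "x \<in> X"
  shows "cycle_vertex f ((f ^^ height f x) x)"
proof -
  have orbit: "(f ^^ k) x \<in> X" for k
    using assms by (induction k) (auto simp: finite_dynamical_system_def)
  have "\<not> inj (\<lambda>k. (f ^^ k) x)"
    using assms orbit finite_subset[of "range (\<lambda>k. (f ^^ k) x)" X]
    by (auto simp: finite_dynamical_system_def dest!: finite_imageD)
  then obtain i j where "i < j" and "(f ^^ i) x = (f ^^ j) x"
    by (metis injI linorder_neqE_nat)
  then have "(f ^^ (j - i)) ((f ^^ i) x) = (f ^^ i) x" and "j - i > 0"
    using funpow_add[of "j - i" i f] by simp_all
  then have "cycle_vertex f ((f ^^ i) x)"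
    unfolding cycle_vertex_def by blast
  then show ?thesis
    unfolding height_def by (rule LeastI)
qed

(* The ring of integers modulo n is 'n mod_ring with n = CARD('n) (at least 2 because
   'n :: nontriv), and its m-th power is ('n mod_ring) ^ 'm with m = CARD('m) (at least 1
   because types are nonempty). *)
lemma module_mod_ring_vec:
  "Modules.module ((*s) :: 'n::nontriv mod_ring \<Rightarrow> 'n mod_ring ^ 'm \<Rightarrow> 'n mod_ring ^ 'm)"
  by unfold_locales (vector algebra_simps)+

end

theory Submission
  imports Defs
begin

text \<open>
  Call \<^term>\<open>y\<close> nilpotent if some iterate of \<^term>\<open>f\<close> kills it. For a linear map, bounding
  heights amounts to bounding how many iterations nilpotent elements survive: if \<^term>\<open>x\<close>
  enters a cycle of length \<open>l\<close> after \<open>h\<close> steps, then \<open>f\<^sup>l x - x\<close> is killed by \<open>f\<^sup>h\<close>; if it is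
  already killed by \<open>f\<^sup>K\<close>, then \<open>f\<^sup>K x\<close> is fixed by \<open>f\<^sup>l\<close> (lemma \<open>height_le\<close>).

  So let \<open>y\<close> be nilpotent. It has to be shown that \<open>m e\<^sub>m\<^sub>a\<^sub>x\<close> iterations kill it. Two
  reductions lead to elements killed by a prime, for which the rank \<open>m\<close> bounds the number of
  iterations by a count.

  \<^item> By Bezout's identity the prime powers dividing \<open>n\<close> can be treated separately, so that
    one may assume \<open>p\<^sup>e y = 0\<close> for a single prime \<open>p\<close> (lemma \<open>torsion_nilpotency_le\<close>).
  \<^item> Since \<open>p\<^sup>e\<^sup>-\<^sup>1 y\<close> is a nilpotent element killed by \<open>p\<close>, a bound of \<open>m\<close> iterations for
    such elements lowers the exponent from \<open>e\<close> to \<open>e - 1\<close> at the cost of \<open>m\<close> iterations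
    (lemma \<open>prime_power_torsion_nilpotency_le\<close>).
  \<^item> The elements killed by \<open>p\<close> form a vector space over the field with \<open>p\<close> elements. It has
    at most \<open>p\<^sup>m\<close> elements, since multiplication by \<open>p\<close> kills at most \<open>p\<close> residues in each
    coordinate. A nilpotent element surviving \<open>k - 1\<close> iterations makes the first \<open>k\<close>
    inclusions between the kernels of successive powers of \<open>f\<close> strict, and each strict
    inclusion costs a factor \<open>p\<close>. Hence \<open>k \<le> m\<close> (lemma \<open>prime_torsion_nilpotency_le\<close>).
\<close>

section \<open>Nilpotent torsion elements of a module endomorphism\<close>

locale module_endomorphism = Modules.module scale
  for scale :: "'r::comm_ring_1 \<Rightarrow> 'v::ab_group_add \<Rightarrow> 'v" (infixr \<open>\<star>\<close> 75) +
  fixes f :: "'v \<Rightarrow> 'v"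
  assumes module_hom_f: "Modules.module_hom scale scale f"
begin

lemma module_hom_funpow: "Modules.module_hom scale scale (f ^^ k)"
proof (induction k)
  case 0
  show ?case
    using module_hom_ident by (simp add: id_def)
next
  case (Suc k)
  show ?case
    using module_hom_compose[OF Suc module_hom_f] by (simp add: o_def)
qed

lemmas funpow_add_distrib = module_hom.add[OF module_hom_funpow]
  and funpow_diff_distrib = module_hom.diff[OF module_hom_funpow]
  and funpow_scale = module_hom.scale[OF module_hom_funpow]
  and funpow_zero [simp] = module_hom.zero[OF module_hom_funpow]

lemma funpow_eq_zero_mono:
  assumes "(f ^^ j) x = 0" and "j \<le> k"
  shows "(f ^^ k) x = 0"
proof -
  have "(f ^^ k) x = (f ^^ (k - j)) ((f ^^ j) x)"
    using assms(2) funpow_add[of "k - j" j f] by simp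
  then show ?thesis
    using assms(1) by simp
qed

text \<open>By Bezout's identity, the annihilator of \<^term>\<open>x\<close> contains 1.\<close>

lemma coprime_annihilators_imp_zero:
  fixes a b :: nat
  assumes "coprime a b" and a: "of_nat a \<star> x = 0" and b: "of_nat b \<star> x = 0"
  shows "x = 0"
proof -
  obtain u v where "u * int a + v * int b = gcd (int a) (int b)"
    using bezout_int by blast
  then have "u * int a + v * int b = 1"
    using assms(1) by (simp add: coprime_iff_gcd_eq_1 flip: coprime_int_iff)
  then have "(of_int (u * int a + v * int b) :: 'r) = 1"
    by (simp only: of_int_1)
  then have "x = (of_int u * of_nat a + of_int v * of_nat b) \<star> x"
    by simp
  also have "\<dots> = of_int u \<star> (of_nat a \<star> x) + of_int v \<star> (of_nat b \<star> x)"
    by (simp add: scale_left_distrib)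
  finally show ?thesis
    by (simp add: a b)
qed

definition torsion_kernel :: "nat \<Rightarrow> nat \<Rightarrow> 'v set" where
  "torsion_kernel p j = {z. of_nat p \<star> z = 0 \<and> (f ^^ j) z = 0}"

text \<open>
  The cosets of the smaller kernel by the multiples \<open>0, w, \<dots>, (p - 1) w\<close> lie in the larger
  one, and they are pairwise disjoint: if two of them met, then a number prime to \<^term>\<open>p\<close>
  would kill \<open>f\<^sup>j w\<close>, and so would \<^term>\<open>p\<close>.
\<close>

lemma prime_mult_card_torsion_kernel_le:
  assumes "prime p" and fin: "finite {z. of_nat p \<star> z = 0}"
    and w: "w \<in> torsion_kernel p (Suc j)" "w \<notin> torsion_kernel p j"
  shows "p * card (torsion_kernel p j) \<le> card (torsion_kernel p (Suc j))"
proof -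
  let ?g = "\<lambda>(a, u). of_nat a \<star> w + u"
  have torsion_w: "of_nat p \<star> w = 0" and kill_w: "(f ^^ Suc j) w = 0"
    and fjw: "(f ^^ j) w \<noteq> 0"
    using w by (auto simp: torsion_kernel_def)
  have *: False
    if ab: "a < b" "b < p" and u: "u \<in> torsion_kernel p j" "u' \<in> torsion_kernel p j"
      and eq: "of_nat a \<star> w + u = of_nat b \<star> w + u'" for a b u u'
  proof -
    have "(f ^^ j) (of_nat a \<star> w + u) = (f ^^ j) (of_nat b \<star> w + u')"
      by (simp only: eq)
    then have "of_nat a \<star> (f ^^ j) w = of_nat b \<star> (f ^^ j) w"
      using u by (simp add: funpow_add_distrib funpow_scale torsion_kernel_def)
    then have "of_nat (b - a) \<star> (f ^^ j) w = 0"
      using ab by (simp add: scale_left_diff_distrib)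
    moreover have "of_nat p \<star> (f ^^ j) w = 0"
      using torsion_w by (simp flip: funpow_scale)
    moreover have "coprime (b - a) p"
    proof -
      have "\<not> p dvd b - a"
        using ab by (auto dest: dvd_imp_le)
      then show ?thesis
        using \<open>prime p\<close> by (simp add: prime_imp_coprime coprime_commute)
    qed
    ultimately show False
      using coprime_annihilators_imp_zero fjw by blast
  qed
  have "inj_on ?g ({..<p} \<times> torsion_kernel p j)"
  proof (rule inj_onI, clarsimp)
    fix a u b u'
    assume "a < p" "b < p" "u \<in> torsion_kernel p j" "u' \<in> torsion_kernel p j"
      and eq: "of_nat a \<star> w + u = of_nat b \<star> w + u'"
    then have "\<not> a < b" "\<not> b < a"
      using *[of a b u u'] *[of b a u' u] by auto
    then show "a = b \<and> u = u'"
      using eq by auto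
  qed
  moreover have "?g ` ({..<p} \<times> torsion_kernel p j) \<subseteq> torsion_kernel p (Suc j)"
  proof clarsimp
    fix a u
    assume "u \<in> torsion_kernel p j"
    then have "of_nat p \<star> u = 0" "(f ^^ Suc j) u = 0"
      using funpow_eq_zero_mono[of j u "Suc j"] by (auto simp: torsion_kernel_def)
    moreover have "of_nat p \<star> (of_nat a \<star> w) = 0"
      using torsion_w by (subst scale_left_commute) simp
    ultimately show "of_nat a \<star> w + u \<in> torsion_kernel p (Suc j)"
      unfolding torsion_kernel_def
      using kill_w by (simp only: mem_Collect_eq funpow_add_distrib funpow_scale
          scale_right_distrib scale_zero_right add_0_left)
  qed
  moreover have "finite (torsion_kernel p (Suc j))"
    using fin by (rule rev_finite_subset) (auto simp: torsion_kernel_def)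
  ultimately have "card ({..<p} \<times> torsion_kernel p j) \<le> card (torsion_kernel p (Suc j))"
    by (rule card_inj_on_le)
  then show ?thesis
    by (simp add: card_cartesian_product)
qed

text \<open>
  If \<open>k\<close> is the least number of iterations that kill \<^term>\<open>z\<close>, then
  \<open>f\<^sup>k\<^sup>-\<^sup>j\<^sup>-\<^sup>1 z\<close> separates the kernels of \<open>f\<^sup>j\<close> and \<open>f\<^sup>j\<^sup>+\<^sup>1\<close> for every \<open>j < k\<close>. So the kernel of
  \<open>f\<^sup>k\<close> has at least \<open>p\<^sup>k\<close> elements of \<open>p\<close>-torsion, which the hypothesis on the cardinality
  allows only for \<open>k \<le> d\<close>.
\<close>

lemma prime_torsion_nilpotency_le:
  assumes p: "prime p" and fin: "finite {z. of_nat p \<star> z = 0}"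
    and card_le: "card {z. of_nat p \<star> z = 0} \<le> p ^ d"
    and z: "of_nat p \<star> z = 0" and nilp: "(f ^^ L) z = 0"
  shows "(f ^^ d) z = 0"
proof -
  define k where "k = (LEAST k. (f ^^ k) z = 0)"
  have k: "(f ^^ k) z = 0"
    unfolding k_def using nilp by (rule LeastI)
  have power_le: "p ^ j \<le> card (torsion_kernel p j)" if "j \<le> k" for j
    using that
  proof (induction j)
    case 0
    have "torsion_kernel p 0 = {0}"
      by (auto simp: torsion_kernel_def)
    then show ?case
      by simp
  next
    case (Suc j)
    let ?w = "(f ^^ (k - Suc j)) z"
    have iterate: "(f ^^ i) ?w = (f ^^ (i + (k - Suc j))) z" for i
      by (simp add: funpow_add)
    have "Suc j + (k - Suc j) = k" "j + (k - Suc j) < k"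
      using Suc.prems by auto
    then have "(f ^^ Suc j) ?w = 0" "(f ^^ j) ?w \<noteq> 0"
      unfolding iterate using k not_less_Least[of "j + (k - Suc j)" "\<lambda>k. (f ^^ k) z = 0"]
      by (simp_all add: k_def)
    moreover have "of_nat p \<star> ?w = 0"
      using z by (simp flip: funpow_scale)
    ultimately have "p * card (torsion_kernel p j) \<le> card (torsion_kernel p (Suc j))"
      by (intro prime_mult_card_torsion_kernel_le[OF p fin, of ?w])
        (auto simp: torsion_kernel_def)
    moreover have "p ^ j \<le> card (torsion_kernel p j)"
      using Suc by simp
    ultimately show ?case
      by (metis mult_le_mono2 order_trans power_Suc)
  qed
  have "p ^ k \<le> card (torsion_kernel p k)"
    by (simp add: power_le)
  also have "\<dots> \<le> card {z. of_nat p \<star> z = 0}"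
    by (rule card_mono[OF fin]) (auto simp: torsion_kernel_def)
  also note card_le
  finally have "k \<le> d"
    using prime_gt_1_nat[OF p] by simp
  then show ?thesis
    using funpow_eq_zero_mono[OF k] by blast
qed

text \<open>
  Multiplying \<^term>\<open>y\<close> by all but one factor \<^term>\<open>p\<close> gives a \<open>p\<close>-torsion element, which
  \<open>f\<^sup>d\<close> kills. So \<open>f\<^sup>d y\<close> is killed by a smaller power of \<^term>\<open>p\<close>, and induction applies to it.
\<close>

lemma prime_power_torsion_nilpotency_le:
  assumes p: "prime p" and fin: "finite {z. of_nat p \<star> z = 0}"
    and card_le: "card {z. of_nat p \<star> z = 0} \<le> p ^ d"
    and "of_nat (p ^ e) \<star> y = 0" and "(f ^^ L) y = 0"
  shows "(f ^^ (d * e)) y = 0"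
  using assms(4,5)
proof (induction e arbitrary: y)
  case 0
  then show ?case
    by simp
next
  case (Suc e)
  have "of_nat p \<star> (of_nat (p ^ e) \<star> y) = 0"
    using Suc.prems(1) by simp
  moreover have "(f ^^ L) (of_nat (p ^ e) \<star> y) = 0"
    using Suc.prems(2) by (simp add: funpow_scale)
  ultimately have "(f ^^ d) (of_nat (p ^ e) \<star> y) = 0"
    by (rule prime_torsion_nilpotency_le[OF p fin card_le])
  then have "of_nat (p ^ e) \<star> (f ^^ d) y = 0"
    by (simp only: funpow_scale)
  moreover have "(f ^^ L) ((f ^^ d) y) = 0"
    using funpow_eq_zero_mono[OF Suc.prems(2), of "L + d"] by (simp add: funpow_add)
  ultimately have "(f ^^ (d * e)) ((f ^^ d) y) = 0"
    by (rule Suc.IH)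
  then show ?case
    by (simp add: funpow_add add.commute[of d])
qed

text \<open>
  In the induction step \<^term>\<open>y\<close> is replaced by two multiples: by the new prime power, which
  leaves an element killed by the remaining product, and by the remaining product, which leaves
  an element killed by the new prime power. As \<open>f\<close> is linear, both factors then annihilate
  the iterate of \<^term>\<open>y\<close>, and they are coprime.
\<close>

lemma torsion_nilpotency_le:
  fixes p e :: "'i \<Rightarrow> nat"
  assumes "finite I" and "\<And>i. i \<in> I \<Longrightarrow> prime (p i)" and "inj_on p I"
    and "\<And>i. i \<in> I \<Longrightarrow> finite {z. of_nat (p i) \<star> z = 0}"
    and "\<And>i. i \<in> I \<Longrightarrow> card {z. of_nat (p i) \<star> z = 0} \<le> p i ^ d"
    and "\<And>i. i \<in> I \<Longrightarrow> e i \<le> E"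
    and "of_nat (\<Prod>i\<in>I. p i ^ e i) \<star> y = 0" and "(f ^^ L) y = 0"
  shows "(f ^^ (d * E)) y = 0"
  using assms
proof (induction I arbitrary: y rule: finite_induct)
  case empty
  then show ?case
    by simp
next
  case (insert i I)
  let ?q = "p i ^ e i" and ?Q = "\<Prod>i\<in>I. p i ^ e i"
  have Qq: "of_nat ?Q \<star> (of_nat ?q \<star> y) = 0" "of_nat ?q \<star> (of_nat ?Q \<star> y) = 0"
    using insert.prems(6) insert.hyps by (simp_all add: mult.commute)
  have nilp: "(f ^^ L) (a \<star> y) = 0" for a
    using insert.prems(7) by (simp add: funpow_scale)
  have "(f ^^ (d * E)) (of_nat ?q \<star> y) = 0"
    using insert.prems Qq(1) nilp by (intro insert.IH) auto
  then have q: "of_nat ?q \<star> (f ^^ (d * E)) y = 0"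
    by (simp only: funpow_scale)
  have "(f ^^ (d * e i)) (of_nat ?Q \<star> y) = 0"
    using insert.prems(1,3,4) Qq(2) nilp by (intro prime_power_torsion_nilpotency_le) auto
  then have "(f ^^ (d * E)) (of_nat ?Q \<star> y) = 0"
    by (rule funpow_eq_zero_mono) (simp add: insert.prems(5))
  then have Q: "of_nat ?Q \<star> (f ^^ (d * E)) y = 0"
    by (simp only: funpow_scale)
  have "coprime (p i) (p j)" if "j \<in> I" for j
    using that insert.prems(1,2) insert.hyps by (intro primes_coprime) (auto simp: inj_on_def)
  then have "coprime ?q ?Q"
    by (intro prod_coprime_right) simp
  then show ?case
    using q Q by (rule coprime_annihilators_imp_zero)
qed

text \<open>
  The kernel hypothesis is used for \<open>f\<^sup>l x - x\<close>, where \<open>l\<close> is the length of a cycle that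
  the orbit of \<^term>\<open>x\<close> reaches: the iterates of this element are the differences between
  points of the orbit \<open>l\<close> steps apart.
\<close>

lemma height_le:
  assumes "finite_dynamical_system X f" and "x \<in> X"
    and ker: "\<And>L y. (f ^^ L) y = 0 \<Longrightarrow> (f ^^ K) y = 0"
  shows "height f x \<le> K"
proof -
  let ?h = "height f x"
  obtain l where l: "l > 0" "(f ^^ l) ((f ^^ ?h) x) = (f ^^ ?h) x"
    using cycle_vertex_height[OF assms(1,2)] by (auto simp: cycle_vertex_def)
  have commute: "(f ^^ l) ((f ^^ k) x) = (f ^^ k) ((f ^^ l) x)" for k
    by (metis add.commute comp_apply funpow_add)
  have "(f ^^ ?h) ((f ^^ l) x - x) = 0"
    using l(2) by (simp add: funpow_diff_distrib flip: commute)
  then have "(f ^^ K) ((f ^^ l) x - x) = 0"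
    by (rule ker)
  then have "(f ^^ l) ((f ^^ K) x) = (f ^^ K) x"
    by (simp add: funpow_diff_distrib commute)
  then have "cycle_vertex f ((f ^^ K) x)"
    using l(1) by (auto simp: cycle_vertex_def)
  then show ?thesis
    unfolding height_def by (rule Least_le)
qed

end

section \<open>Counting torsion in powers of the integers modulo n\<close>

text \<open>
  If \<open>k x\<close> is a multiple \<open>t n\<close> of the modulus, where \<open>0 \<le> x < n\<close>, then \<open>0 \<le> t < k\<close>, and
  \<open>t\<close> determines \<open>x\<close>.
\<close>

lemma card_torsion_mod_ring_le:
  assumes "k > 0"
  shows "card {a :: 'n::nontriv mod_ring. of_nat k * a = 0} \<le> k"
proof -
  let ?n = "int CARD('n)"
  let ?g = "\<lambda>a :: 'n mod_ring. int k * to_int_mod_ring a div ?n"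
  have dvd: "?n dvd int k * to_int_mod_ring a" if "of_nat k * a = 0" for a :: "'n mod_ring"
  proof -
    have "of_int (to_int_mod_ring a) = a"
      by (simp add: of_int_of_int_mod_ring)
    then have "(of_int (int k * to_int_mod_ring a) :: 'n mod_ring) = of_nat k * a"
      by (simp only: of_int_mult of_int_of_nat_eq)
    then have "(of_int (int k * to_int_mod_ring a) :: 'n mod_ring) = 0"
      by (simp only: that)
    then show ?thesis
      by (simp only: of_int_eq_0_iff_char_dvd semiring_char_mod_ring)
  qed
  have "inj_on ?g {a. of_nat k * a = 0}"
  proof (rule inj_onI)
    fix a b :: "'n mod_ring"
    assume a: "a \<in> {a. of_nat k * a = 0}" and b: "b \<in> {a. of_nat k * a = 0}"
      and eq: "?g a = ?g b"
    have "int k * to_int_mod_ring a = ?g a * ?n"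
      using a dvd[of a] by simp
    also have "\<dots> = ?g b * ?n"
      by (simp only: eq)
    also have "\<dots> = int k * to_int_mod_ring b"
      using b dvd[of b] by simp
    finally have "int k * to_int_mod_ring a = int k * to_int_mod_ring b" .
    then show "a = b"
      using assms by simp
  qed
  moreover have "?g ` {a. of_nat k * a = 0} \<subseteq> {0..<int k}"
  proof (rule image_subsetI)
    fix a :: "'n mod_ring"
    assume a: "a \<in> {a. of_nat k * a = 0}"
    have "to_int_mod_ring a \<in> {0..<?n}"
      unfolding range_to_int_mod_ring[symmetric] by (rule rangeI)
    then have range: "0 \<le> to_int_mod_ring a" "to_int_mod_ring a < ?n"
      by simp_all
    have "?g a * ?n = int k * to_int_mod_ring a"
      using a dvd[of a] by simp
    also have "\<dots> < int k * ?n"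
      using range(2) assms by (intro mult_strict_left_mono) simp_all
    finally have "?g a < int k"
      by (rule mult_right_less_imp_less) simp
    moreover have "0 \<le> ?g a"
      using range(1) by (simp add: pos_imp_zdiv_nonneg_iff)
    ultimately show "?g a \<in> {0..<int k}"
      by simp
  qed
  ultimately have "card {a :: 'n mod_ring. of_nat k * a = 0} \<le> card {0..<int k}"
    by (intro card_inj_on_le) auto
  then show ?thesis
    by simp
qed

lemma card_torsion_vec_le:
  assumes "k > 0"
  shows "card {v :: 'n::nontriv mod_ring ^ 'm::finite. of_nat k *s v = 0} \<le> k ^ CARD('m)"
proof -
  let ?T = "{a :: 'n mod_ring. of_nat k * a = 0}"
  have "card {v :: 'n mod_ring ^ 'm. of_nat k *s v = 0} \<le> card (PiE (UNIV :: 'm set) (\<lambda>_. ?T))"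
  proof (rule card_inj_on_le)
    show "inj_on vec_nth {v :: 'n mod_ring ^ 'm. of_nat k *s v = 0}"
      by (simp add: inj_on_def vec_nth_inject)
    show "vec_nth ` {v :: 'n mod_ring ^ 'm. of_nat k *s v = 0} \<subseteq> PiE UNIV (\<lambda>_. ?T)"
      by (auto simp: vec_eq_iff)
  qed (simp add: finite_PiE)
  also have "\<dots> = card ?T ^ CARD('m)"
    by (simp add: card_PiE)
  also have "\<dots> \<le> k ^ CARD('m)"
    by (intro power_mono card_torsion_mod_ring_le assms) simp
  finally show ?thesis .
qed

section \<open>The bound on the system height\<close>

theorem theoremA:
  fixes f :: "'n::nontriv mod_ring ^ 'm::finite \<Rightarrow> 'n mod_ring ^ 'm"
    and n m \<omega> s :: nat
    and p e :: "nat \<Rightarrow> nat"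
  assumes "n = CARD('n)" and "m = CARD('m)"
    and "Modules.module_hom (*s) (*s) f"
    and "s = system_height UNIV f"
    and "\<And>i. i \<in> {1..\<omega>} \<Longrightarrow> prime (p i)"
    and "inj_on p {1..\<omega>}"
    and "\<And>i. i \<in> {1..\<omega>} \<Longrightarrow> e i \<ge> 1"
    and "n = (\<Prod>i = 1..\<omega>. p i ^ e i)"
  shows "s \<le> m * Max (e ` {1..\<omega>})"
proof -
  let ?K = "m * Max (e ` {1..\<omega>})"
  interpret module_endomorphism "(*s)" f
    using module_mod_ring_vec assms(3)
    by (simp add: module_endomorphism_def module_endomorphism_axioms_def)
  have "(of_nat n :: 'n mod_ring) = 0"
    by (simp add: assms(1))
  then have "of_nat (\<Prod>i = 1..\<omega>. p i ^ e i) *s y = 0" for y :: "'n mod_ring ^ 'm"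
    by (simp only: assms(8)[symmetric] vector_smult_lzero)
  then have "(f ^^ ?K) y = 0" if "(f ^^ L) y = 0" for L y
    using assms(2,5,6) that
    by (intro torsion_nilpotency_le[of "{1..\<omega>}" p m e])
      (auto simp: card_torsion_vec_le prime_gt_0_nat)
  then have "height f x \<le> ?K" for x
    by (intro height_le[of UNIV]) (simp_all add: finite_dynamical_system_def)
  then show ?thesis
    by (simp add: assms(4) system_height_def)
qed

end
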